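(* Suppose the evaluation distribution $F$ is a regular distribution, i.e. $\lambda\mapsto\lambda\bar F^{-1}(\lambda/\Lambda)$ is a continuous concave function on $[0,\Lambda]$. Then for any integer $K$ with $m\le K\le N$, the cutoff-static policy $\pi_K^{\hat\delta}$ satisfies $$\mathbf R(\pi_K^{\hat\delta})\ \ge\ \mathbf R(\vec\lambda^* )\times\left(1-\frac{a_K(\Lambda)}{\sum_{n=0}^K a_n(\Lambda)}\right).$$
   Context: Model: a Markovian queue with $m$ servers, capacity $N$, maximal arrival rate $\Lambda$, service rate $\mu$, abandonment rates $\theta_s$ (in service) and $\theta_q$ (waiting), holding cost $c_h$, abandonment costs $c_s$ (in service) and $c_q$ (waiting). The parameters are integers $1\le m\le N<\infty$ and reals $\Lambda>0$, $\mu>0$, $\theta_q>0$, $\theta_s\ge 0$, $c_h,c_q,c_s\ge 0$, $0\le a<b<\infty$. $F$ is a continuous cumulative distribution function supported on $[a,b]$ ($F(a)=0$, $F(b)=1$) with a positive density on $[a,b]$; $\bar F=1-F$, and for $y\in[0,1]$, $\bar F^{-1}(y)=\inf\{x\in[a,b]:\bar F(x)\le y\}$. Death rates: $\gamma_n=\min\{n,m\}(\mu+\theta_s)+\max\{n-m,0\}\theta_q$. The time unit is scaled so that $\Lambda+m(\mu+\theta_s)+(N-m)\theta_q=1$. Markov decision process: states $\{0,\ldots,N\}$; actions $A_n=[0,\Lambda]$ for $n<N$ and $A_N=\{0\}$; rewards $r_n(\lambda)=\lambda\bar F^{-1}(\lambda/\Lambda)-nc_h-\min\{n,m\}c_s\theta_s-\max\{n-m,0\}c_q\theta_q$;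 transition probabilities $\mathbf P(n+1|n,\lambda)=\lambda$ for $n\le N-1$, $\mathbf P(n-1|n,\lambda)=\gamma_n$ for $n\ge1$, $\mathbf P(n|n,\lambda)=1-\lambda-\gamma_n$, and $0$ otherwise. Let $g^*\in\mathbb R$ and $h:\{0,\ldots,N\}\to\mathbb R$ solve the Bellman equations $g^*+h(n)=\max_{\lambda\in A_n}\{r_n(\lambda)+\sum_{j=0}^N\mathbf P(j|n,\lambda)h(j)\}$, $n=0,\ldots,N$. The optimal arrival rate policy $\vec\lambda^*=(\lambda^*_0,\ldots,\lambda^*_N)$ is $\lambda_n^*=\inf(\arg\max_{\lambda\in A_n}\{r_n(\lambda)+\sum_{j=0}^N\mathbf P(j|n,\lambda)h(j)\})$. Policies: an arrival rate policy is $\vec\lambda\in\Pi=[0,\Lambda]^N\times\{0\}$. Its steady-state probabilities are $P_n(\vec\lambda)=a_n(\vec\lambda)/\sum_{i=0}^N a_i(\vec\lambda)$ with $a_0(\vec\lambda)=1$, $a_n(\vec\lambda)=\prod_{i=1}^n\lambda_{i-1}/\gamma_i$. Long-run average revenue: $\mathbf R(\vec\lambda)=\sum_{n=0}^N\lambda_n\bar F^{-1}(\lambda_n/\Lambda)P_n(\vec\lambda)$. Effective arrival rate under the optimal policy: $\hat\delta=\sum_{n=0}^N\lambda_n^*P_n(\vec\lambda^* )$. Cutoff-static policy: for $K\in\{0,\ldots,N\}$ and $\delta\in[0,\Lambda]$, $\pi_K^\delta\in\Pi$ has arrival rate $\delta$ in states $0\le n<K$ and $0$ in states $K\le n\le N$.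 For a number $\delta$ and $0\le n\le K$, $a_n(\delta)=\prod_{i=1}^n\delta/\gamma_i$ ($a_0(\delta)=1$). *)

theory Defs
  imports "HOL-Probability.Probability"
begin

record queue =
  servers :: nat                   (* m *)
  capacity :: nat                  (* N *)
  max_rate :: real                 (* Lambda *)
  service_rate :: real             (* mu *)
  abandon_service :: real          (* theta_s *)
  abandon_wait :: real             (* theta_q *)
  hold_cost :: real                (* c_h *)
  cost_service :: real             (* c_s *)
  cost_wait :: real                (* c_q *)
  val_min :: real                  (* a *)
  val_max :: real                  (* b *)
  valuation :: "real measure"      (* the law whose distribution function is F *)

definition valid_parameters :: "queue \<Rightarrow> bool" where
  "valid_parameters Q \<longleftrightarrow>
     1 \<le> servers Q \<and> servers Q \<le> capacity Q \<and>
     max_rate Q > 0 \<and> service_rate Q > 0 \<and> abandon_wait Q > 0 \<and> abandon_service Q \<ge> 0 \<and>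
     hold_cost Q \<ge> 0 \<and> cost_wait Q \<ge> 0 \<and> cost_service Q \<ge> 0 \<and>
     0 \<le> val_min Q \<and> val_min Q < val_max Q"

definition time_scaled :: "queue \<Rightarrow> bool" where
  "time_scaled Q \<longleftrightarrow>
     max_rate Q + real (servers Q) * (service_rate Q + abandon_service Q)
       + (real (capacity Q) - real (servers Q)) * abandon_wait Q = 1"

abbreviation F :: "queue \<Rightarrow> real \<Rightarrow> real" where
  "F Q \<equiv> cdf (valuation Q)"

definition valid_valuation :: "queue \<Rightarrow> bool" where
  "valid_valuation Q \<longleftrightarrow>
     real_distribution (valuation Q) \<and>
     continuous_on UNIV (F Q) \<and> F Q (val_min Q) = 0 \<and> F Q (val_max Q) = 1 \<and>
     (\<exists>f :: real \<Rightarrow> real. f \<in> borel_measurable borel \<and> (\<forall>x. f x \<ge> 0) \<and>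
        (\<forall>x \<in> {val_min Q..val_max Q}. f x > 0) \<and>
        valuation Q = density lborel (\<lambda>x. ennreal (f x)))"

definition queue_model :: "queue \<Rightarrow> bool" where
  "queue_model Q \<longleftrightarrow> valid_parameters Q \<and> time_scaled Q \<and> valid_valuation Q"

definition Fbar :: "queue \<Rightarrow> real \<Rightarrow> real" where
  "Fbar Q x = 1 - F Q x"

(* Meaningful for y in [0,1] only, where the set is nonempty (it contains b) and bounded. *)
definition Fbar_inv :: "queue \<Rightarrow> real \<Rightarrow> real" where
  "Fbar_inv Q y = Inf {x \<in> {val_min Q..val_max Q}. Fbar Q x \<le> y}"

definition revenue_rate :: "queue \<Rightarrow> real \<Rightarrow> real" where
  "revenue_rate Q l = l * Fbar_inv Q (l / max_rate Q)"

definition regular_valuation :: "queue \<Rightarrow> bool" where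
  "regular_valuation Q \<longleftrightarrow>
     continuous_on {0..max_rate Q} (revenue_rate Q) \<and>
     concave_on {0..max_rate Q} (revenue_rate Q)"

definition death_rate :: "queue \<Rightarrow> nat \<Rightarrow> real" where
  "death_rate Q n =
     min (real n) (real (servers Q)) * (service_rate Q + abandon_service Q)
       + max (real n - real (servers Q)) 0 * abandon_wait Q"

definition actions :: "queue \<Rightarrow> nat \<Rightarrow> real set" where
  "actions Q n = (if n < capacity Q then {0..max_rate Q} else {0})"

definition reward :: "queue \<Rightarrow> nat \<Rightarrow> real \<Rightarrow> real" where
  "reward Q n l =
     revenue_rate Q l - real n * hold_cost Q
       - min (real n) (real (servers Q)) * cost_service Q * abandon_service Q
       - max (real n - real (servers Q)) 0 * cost_wait Q * abandon_wait Q"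

(* trans_prob Q n l j is the probability P(j | n, l) of moving from n to j under action l. *)
definition trans_prob :: "queue \<Rightarrow> nat \<Rightarrow> real \<Rightarrow> nat \<Rightarrow> real" where
  "trans_prob Q n l j =
     (if j = n + 1 \<and> n < capacity Q then l
      else if j + 1 = n then death_rate Q n
      else if j = n then 1 - l - death_rate Q n
      else 0)"

definition bellman_rhs :: "queue \<Rightarrow> (nat \<Rightarrow> real) \<Rightarrow> nat \<Rightarrow> real \<Rightarrow> real" where
  "bellman_rhs Q h n l = reward Q n l + (\<Sum>j = 0..capacity Q. trans_prob Q n l j * h j)"

definition bellman_argmax :: "queue \<Rightarrow> (nat \<Rightarrow> real) \<Rightarrow> nat \<Rightarrow> real set" where
  "bellman_argmax Q h n = {l. is_arg_max (bellman_rhs Q h n) (\<lambda>l. l \<in> actions Q n) l}"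

(* The action sets are infinite, so "max" is expressed as the value at some maximizer;
   in particular it is attained. Only the values h 0, ..., h N are used. *)
definition solves_bellman :: "queue \<Rightarrow> real \<Rightarrow> (nat \<Rightarrow> real) \<Rightarrow> bool" where
  "solves_bellman Q g h \<longleftrightarrow>
     (\<forall>n \<le> capacity Q. \<exists>l \<in> bellman_argmax Q h n. g + h n = bellman_rhs Q h n l)"

(* Policies are functions on nat of which only the values at 0, ..., N are used. *)
definition optimal_policy :: "queue \<Rightarrow> (nat \<Rightarrow> real) \<Rightarrow> nat \<Rightarrow> real" where
  "optimal_policy Q h n = Inf (bellman_argmax Q h n)"

definition weight :: "queue \<Rightarrow> (nat \<Rightarrow> real) \<Rightarrow> nat \<Rightarrow> real" where
  "weight Q p n = (\<Prod>i = 1..n. p (i - 1) / death_rate Q i)"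

definition steady_prob :: "queue \<Rightarrow> (nat \<Rightarrow> real) \<Rightarrow> nat \<Rightarrow> real" where
  "steady_prob Q p n = weight Q p n / (\<Sum>i = 0..capacity Q. weight Q p i)"

definition avg_revenue :: "queue \<Rightarrow> (nat \<Rightarrow> real) \<Rightarrow> real" where
  "avg_revenue Q p =
     (\<Sum>n = 0..capacity Q. p n * Fbar_inv Q (p n / max_rate Q) * steady_prob Q p n)"

definition effective_rate :: "queue \<Rightarrow> (nat \<Rightarrow> real) \<Rightarrow> real" where
  "effective_rate Q p = (\<Sum>n = 0..capacity Q. p n * steady_prob Q p n)"

definition cutoff_static :: "nat \<Rightarrow> real \<Rightarrow> nat \<Rightarrow> real" where
  "cutoff_static K d n = (if n < K then d else 0)"

definition const_weight :: "queue \<Rightarrow> real \<Rightarrow> nat \<Rightarrow> real" where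
  "const_weight Q d n = (\<Prod>i = 1..n. d / death_rate Q i)"

end

theory Submission
  imports Defs
begin

text \<open>
  Let \<open>\<rho>\<close> be the revenue rate \<open>\<lambda> \<mapsto> \<lambda> * Fbar_inv (\<lambda> / \<Lambda>)\<close>, and \<open>\<delta>\<close> the effective arrival rate
  of the optimal policy. It is compared with the cutoff-static policy through the number \<open>\<rho> \<delta>\<close>.

  The average revenue of a policy is the mean of \<open>\<rho>\<close> over its arrival rates under the
  steady-state law, and \<open>\<delta>\<close> is the mean of the optimal rates. As \<open>\<rho>\<close> is concave, Jensen's inequality
  bounds the optimal policy's revenue by \<open>\<rho> \<delta>\<close> (\<open>avg_revenue_le_revenue_rate_effective\<close>).

  The cutoff-static policy turns the queue into a loss system of capacity \<open>K\<close>: it earns \<open>\<rho> \<delta>\<close>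
  except while the system is full, so its revenue is \<open>\<rho> \<delta> * (1 - B \<delta>)\<close>, where \<open>B d\<close> is the
  stationary blocking probability at arrival rate \<open>d\<close> (\<open>avg_revenue_cutoff_static\<close>). Since \<open>B\<close>
  increases with the arrival rate (\<open>blocking_prob_mono\<close>), \<open>\<delta> \<le> \<Lambda>\<close> and \<open>\<rho> \<delta> \<ge> 0\<close>, this revenue is
  at least \<open>\<rho> \<delta> * (1 - B \<Lambda>)\<close>, and the two bounds combine.
\<close>

lemma death_rate_pos:
  assumes "valid_parameters Q" "1 \<le> n"
  shows "death_rate Q n > 0"
proof -
  have "min (real n) (real (servers Q)) * (service_rate Q + abandon_service Q) > 0"
    using assms by (intro mult_pos_pos) (auto simp: valid_parameters_def)
  moreover have "max (real n - real (servers Q)) 0 * abandon_wait Q \<ge> 0"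
    using assms by (intro mult_nonneg_nonneg) (auto simp: valid_parameters_def)
  ultimately show ?thesis
    by (simp add: death_rate_def)
qed

lemma weight_nonneg:
  assumes "valid_parameters Q" "\<And>i. i < n \<Longrightarrow> 0 \<le> p i"
  shows "0 \<le> weight Q p n"
  unfolding weight_def
proof (intro prod_nonneg ballI divide_nonneg_nonneg)
  fix i assume i: "i \<in> {1..n}"
  then show "0 \<le> p (i - 1)" using assms(2)[of "i - 1"] by auto
  show "0 \<le> death_rate Q i" using death_rate_pos[OF assms(1), of i] i by simp
qed

lemma const_weight_eq_weight: "const_weight Q d n = weight Q (\<lambda>_. d) n"
  by (simp add: const_weight_def weight_def)

lemma sum_weight_pos:
  assumes "valid_parameters Q" "\<And>i. i < N \<Longrightarrow> 0 \<le> p i"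
  shows "0 < (\<Sum>n = 0..N. weight Q p n)"
proof (rule sum_pos2[of _ 0])
  show "0 < weight Q p 0" by (simp add: weight_def)
  show "0 \<le> weight Q p n" if "n \<in> {0..N}" for n
    using that assms(2) by (intro weight_nonneg[OF assms(1)]) auto
qed simp_all

lemma steady_prob_nonneg:
  assumes "valid_parameters Q" "\<And>i. i < capacity Q \<Longrightarrow> 0 \<le> p i" "n \<le> capacity Q"
  shows "0 \<le> steady_prob Q p n"
  unfolding steady_prob_def using assms
  by (intro divide_nonneg_pos weight_nonneg sum_weight_pos) auto

lemma sum_steady_prob:
  assumes "valid_parameters Q" "\<And>i. i < capacity Q \<Longrightarrow> 0 \<le> p i"
  shows "(\<Sum>n = 0..capacity Q. steady_prob Q p n) = 1"
proof -
  have "0 < (\<Sum>n = 0..capacity Q. weight Q p n)"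
    using assms by (rule sum_weight_pos)
  then show ?thesis
    by (simp add: steady_prob_def flip: sum_divide_distrib)
qed

lemma avg_revenue_eq:
  "avg_revenue Q p = (\<Sum>n = 0..capacity Q. steady_prob Q p n * revenue_rate Q (p n))"
  by (simp add: avg_revenue_def revenue_rate_def mult_ac)

text \<open>
  Prices are at least \<open>a \<ge> 0\<close>: the set whose infimum defines \<open>Fbar_inv\<close> lies in \<open>[a, b]\<close> and
  contains \<open>b\<close>, so it is nonempty and its infimum is no default value.
\<close>
lemma revenue_rate_nonneg:
  assumes "queue_model Q" "0 \<le> l"
  shows "0 \<le> revenue_rate Q l"
proof -
  let ?S = "{x \<in> {val_min Q..val_max Q}. Fbar Q x \<le> l / max_rate Q}"
  have "val_max Q \<in> ?S"
    using assms
    by (auto simp: queue_model_def valid_parameters_def valid_valuation_def Fbar_def)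
  moreover have "0 \<le> val_min Q"
    using assms by (simp add: queue_model_def valid_parameters_def)
  ultimately have "0 \<le> Inf ?S"
    by (intro cInf_greatest) auto
  then show ?thesis
    using assms(2) by (simp add: revenue_rate_def Fbar_inv_def)
qed

lemma effective_rate_bounds:
  assumes "valid_parameters Q"
    and p: "\<And>n. n \<le> capacity Q \<Longrightarrow> p n \<in> {0..max_rate Q}"
  shows "effective_rate Q p \<in> {0..max_rate Q}"
proof -
  have prob: "0 \<le> steady_prob Q p n" if "n \<le> capacity Q" for n
    using that p by (intro steady_prob_nonneg[OF assms(1)]) auto
  have "effective_rate Q p \<le> (\<Sum>n = 0..capacity Q. max_rate Q * steady_prob Q p n)"
    unfolding effective_rate_def using p prob by (intro sum_mono mult_right_mono) auto
  also have "\<dots> = max_rate Q"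
    using sum_steady_prob[of Q p] assms by (simp flip: sum_distrib_left)
  finally have "effective_rate Q p \<le> max_rate Q" .
  moreover have "0 \<le> effective_rate Q p"
    unfolding effective_rate_def using p prob by (intro sum_nonneg mult_nonneg_nonneg) auto
  ultimately show ?thesis by simp
qed

text \<open>
  Jensen's inequality for the steady-state law: by concavity, fluctuation of the arrival rate
  around its mean can only lose revenue.
\<close>
lemma avg_revenue_le_revenue_rate_effective:
  assumes "valid_parameters Q" "regular_valuation Q"
    and p: "\<And>n. n \<le> capacity Q \<Longrightarrow> p n \<in> {0..max_rate Q}"
  shows "avg_revenue Q p \<le> revenue_rate Q (effective_rate Q p)"
proof -
  have "(\<Sum>n = 0..capacity Q. steady_prob Q p n * revenue_rate Q (p n))
          \<le> revenue_rate Q (\<Sum>n = 0..capacity Q. steady_prob Q p n *\<^sub>R p n)"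
  proof (rule concave_on_sum)
    show "concave_on {0..max_rate Q} (revenue_rate Q)"
      using assms(2) by (simp add: regular_valuation_def)
    show "(\<Sum>n = 0..capacity Q. steady_prob Q p n) = 1"
      using p by (intro sum_steady_prob[OF assms(1)]) auto
    show "0 \<le> steady_prob Q p n" if "n \<in> {0..capacity Q}" for n
      using that p by (intro steady_prob_nonneg[OF assms(1)]) auto
  qed (use p in auto)
  then show ?thesis
    by (simp add: avg_revenue_eq effective_rate_def mult_ac)
qed

lemma weight_cutoff_static:
  "weight Q (cutoff_static K d) n = (if n \<le> K then const_weight Q d n else 0)"
proof (cases "n \<le> K")
  case True
  then show ?thesis
    unfolding weight_def const_weight_def cutoff_static_def by (auto intro!: prod.cong)
next
  case False
  then have "Suc K \<in> {1..n}" "cutoff_static K d (Suc K - 1) / death_rate Q (Suc K) = 0"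
    by (auto simp: cutoff_static_def)
  with False show ?thesis
    unfolding weight_def by (auto intro!: prod_zero bexI[of _ "Suc K"])
qed

lemma sum_weight_cutoff_static:
  assumes "K \<le> N"
  shows "(\<Sum>n = 0..N. weight Q (cutoff_static K d) n) = (\<Sum>n = 0..K. const_weight Q d n)"
proof -
  have "(\<Sum>n = 0..N. weight Q (cutoff_static K d) n)
          = (\<Sum>n = 0..K. weight Q (cutoff_static K d) n)"
    using assms by (intro sum.mono_neutral_right) (auto simp: weight_cutoff_static)
  then show ?thesis by (simp add: weight_cutoff_static)
qed

text \<open>
  Under the cutoff-static policy the chain lives on the states up to \<open>K\<close>, and every state but
  the full one, \<open>K\<close>, earns at the same rate.
\<close>
lemma avg_revenue_cutoff_static:
  assumes "valid_parameters Q" "K \<le> capacity Q" "0 \<le> d"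
  shows "avg_revenue Q (cutoff_static K d)
           = revenue_rate Q d * (1 - const_weight Q d K / (\<Sum>n = 0..K. const_weight Q d n))"
proof -
  let ?P = "steady_prob Q (cutoff_static K d)"
  have total: "(\<Sum>n = 0..capacity Q. ?P n) = 1"
    using assms by (intro sum_steady_prob) (auto simp: cutoff_static_def)
  have P_K: "?P K = const_weight Q d K / (\<Sum>n = 0..K. const_weight Q d n)"
    unfolding steady_prob_def sum_weight_cutoff_static[OF assms(2)]
    by (simp add: weight_cutoff_static)
  have summand: "?P n * revenue_rate Q (cutoff_static K d n)
                = revenue_rate Q d * (?P n - (if n = K then ?P K else 0))" for n
    by (cases n K rule: linorder_cases)
      (simp_all add: cutoff_static_def revenue_rate_def steady_prob_def weight_cutoff_static)
  have "avg_revenue Q (cutoff_static K d) = revenue_rate Q d * (1 - ?P K)"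
    using assms(2) total
    by (simp add: avg_revenue_eq summand sum_subtractf flip: sum_distrib_left)
  then show ?thesis by (simp only: P_K)
qed

text \<open>
  The fraction is the stationary probability that a loss system with \<open>K\<close> places is full. After
  cross-multiplication the claim holds term by term, because
  \<open>d ^ K * e ^ n \<le> e ^ K * d ^ n\<close> for \<open>n \<le> K\<close>.
\<close>
lemma blocking_prob_mono:
  assumes Q: "valid_parameters Q" and de: "0 \<le> d" "d \<le> e"
  shows "const_weight Q d K / (\<Sum>n = 0..K. const_weight Q d n)
           \<le> const_weight Q e K / (\<Sum>n = 0..K. const_weight Q e n)"
proof -
  define c where "c n = (\<Prod>i = 1..n. 1 / death_rate Q i)" for n
  have cw: "const_weight Q x n = x ^ n * c n" for x n
    unfolding const_weight_def c_def
    by (simp add: prod_dividef)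
  have c: "0 \<le> c n" for n
    unfolding c_def using death_rate_pos[OF Q] by (intro prod_nonneg) (auto intro: less_imp_le)
  have key: "const_weight Q d K * const_weight Q e n \<le> const_weight Q e K * const_weight Q d n"
    if "n \<le> K" for n
  proof -
    have split: "x ^ K = x ^ (K - n) * x ^ n" for x :: real
      using that by (simp flip: power_add)
    have "0 \<le> d ^ n * e ^ n * (c K * c n)"
      using de c[of K] c[of n] by simp
    then have "d ^ (K - n) * (d ^ n * e ^ n * (c K * c n))
                 \<le> e ^ (K - n) * (d ^ n * e ^ n * (c K * c n))"
      using power_mono[OF de(2,1), of "K - n"] by (rule mult_right_mono[rotated])
    then show ?thesis
      unfolding cw split by (simp only: mult_ac)
  qed
  have "const_weight Q d K * (\<Sum>n = 0..K. const_weight Q e n)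
          \<le> const_weight Q e K * (\<Sum>n = 0..K. const_weight Q d n)"
    unfolding sum_distrib_left using key by (intro sum_mono) auto
  moreover have pos: "0 < (\<Sum>n = 0..K. const_weight Q x n)" if "0 \<le> x" for x
    unfolding const_weight_eq_weight using that by (intro sum_weight_pos[OF Q]) auto
  moreover have "0 \<le> e" using de by simp
  ultimately show ?thesis
    using de(1) by (simp only: pos_divide_le_eq[OF pos] pos_le_divide_eq[OF pos] times_divide_eq_left)
qed

text \<open>
  The Bellman equations provide a maximizer in every state, so the infimum defining the optimal
  rate is taken over a nonempty subset of \<open>[0, \<Lambda>]\<close>.
\<close>
lemma optimal_policy_bounds:
  assumes "valid_parameters Q" "solves_bellman Q g h" "n \<le> capacity Q"
  shows "optimal_policy Q h n \<in> {0..max_rate Q}"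
proof -
  obtain l where l: "l \<in> bellman_argmax Q h n"
    using assms by (auto simp: solves_bellman_def)
  have sub: "bellman_argmax Q h n \<subseteq> {0..max_rate Q}"
    using assms(1)
    by (auto simp: bellman_argmax_def is_arg_max_def actions_def valid_parameters_def
        split: if_splits)
  have "Inf (bellman_argmax Q h n) \<le> l"
    using l sub by (intro cInf_lower) (auto intro: bdd_below_mono[of "{0..max_rate Q}"])
  moreover have "0 \<le> Inf (bellman_argmax Q h n)"
    using l sub by (intro cInf_greatest) auto
  moreover have "l \<le> max_rate Q"
    using l sub by auto
  ultimately show ?thesis
    unfolding optimal_policy_def by simp
qed

theorem theorem5p2:
  fixes Q :: queue and g :: real and h :: "nat \<Rightarrow> real" and K :: nat
  assumes model: "queue_model Q"
    and regular: "regular_valuation Q"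
    and bellman: "solves_bellman Q g h"
    and K: "servers Q \<le> K" "K \<le> capacity Q"
  shows "avg_revenue Q (cutoff_static K (effective_rate Q (optimal_policy Q h)))
           \<ge> avg_revenue Q (optimal_policy Q h)
              * (1 - const_weight Q (max_rate Q) K
                       / (\<Sum>n = 0..K. const_weight Q (max_rate Q) n))"
proof -
  define p where "p = optimal_policy Q h"
  define \<delta> where "\<delta> = effective_rate Q p"
  define B where "B d = const_weight Q d K / (\<Sum>n = 0..K. const_weight Q d n)" for d
  have Q: "valid_parameters Q" using model by (simp add: queue_model_def)
  have p: "p n \<in> {0..max_rate Q}" if "n \<le> capacity Q" for n
    unfolding p_def using optimal_policy_bounds[OF Q bellman that] .
  have \<delta>: "0 \<le> \<delta>" "\<delta> \<le> max_rate Q"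
    using effective_rate_bounds[where p = p, OF Q p] by (auto simp: \<delta>_def)
  have "B (max_rate Q) \<le> 1"
  proof -
    have weight: "0 \<le> const_weight Q (max_rate Q) n" for n
      unfolding const_weight_eq_weight using \<delta> by (intro weight_nonneg[OF Q]) auto
    then have "const_weight Q (max_rate Q) K \<le> (\<Sum>n = 0..K. const_weight Q (max_rate Q) n)"
      by (intro member_le_sum) auto
    moreover have "0 < (\<Sum>n = 0..K. const_weight Q (max_rate Q) n)"
      unfolding const_weight_eq_weight using \<delta> by (intro sum_weight_pos[OF Q]) auto
    ultimately show ?thesis
      unfolding B_def by simp
  qed
  then have "avg_revenue Q p * (1 - B (max_rate Q)) \<le> revenue_rate Q \<delta> * (1 - B (max_rate Q))"
    using avg_revenue_le_revenue_rate_effective[where p = p, OF Q regular p]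
    by (intro mult_right_mono) (auto simp: \<delta>_def)
  also have "\<dots> \<le> revenue_rate Q \<delta> * (1 - B \<delta>)"
    using blocking_prob_mono[OF Q \<delta>] revenue_rate_nonneg[OF model \<delta>(1)]
    by (intro mult_left_mono) (auto simp: B_def)
  also have "\<dots> = avg_revenue Q (cutoff_static K \<delta>)"
    using avg_revenue_cutoff_static[OF Q K(2) \<delta>(1)] by (simp add: B_def)
  finally show ?thesis by (simp add: p_def \<delta>_def B_def)
qed

end
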